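(* Let $R\subseteq T$ be an extension of graded domains. Suppose that the canonical continuous map $F:\operatorname{Spec}_h(T)\to\operatorname{Spec}_h(R)$, $Q\mapsto Q\cap R$, is open (with respect to the subspace topologies induced by the Zariski topologies on $\operatorname{Spec}(T)$ and $\operatorname{Spec}(R)$). Then $R\subseteq T$ satisfies gGD.
   Context: All rings are commutative with identity. A graded domain $R=\bigoplus_{\alpha\in\Gamma}R_\alpha$ is an integral domain graded by a nonzero torsionless commutative cancellative monoid $\Gamma$, written additively (torsionless is equivalent to the existence of a total order compatible with the monoid operation). An ideal is homogeneous if it is generated by homogeneous elements; $\operatorname{Spec}_h(R)$ is the set of homogeneous prime ideals of $R$. An extension of graded domains $R\subseteq T$ means: $R$ is a $\Gamma$-graded domain, $T=\bigoplus_{\alpha\in\Lambda}T_\alpha$ is a graded domain graded by a torsionless commutative cancellative monoid $\Lambda$, $R$ is a subring of $T$, $\Gamma$ is a subsemigroup of $\Lambda$, and $R_\alpha\subseteq T_\alpha$ for all $\alpha\in\Gamma$. It satisfies gGD (graded going-down) if, whenever $P_0\subseteq P$ are homogeneous prime ideals of $R$ and $Q$ is a homogeneous prime ideal of $T$ with $Q\cap R=P$, there is a homogeneous prime ideal $Q_0$ of $T$ with $Q_0\subseteq Q$ and $Q_0\cap R=P_0$. *)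

theory Defs
  imports
    "HOL-Algebra.Divisibility"
    "HOL-Algebra.Ideal"
    "HOL-Algebra.Subrings"
    "HOL-Analysis.Abstract_Topology"
begin

section \<open>Graded domains\<close>

text \<open>
  Grading monoids are written multiplicatively, following HOL-Algebra: the condition
  \<open>n a = n b \<Longrightarrow> a = b\<close> for \<open>n \<ge> 1\<close> of the additive notation becomes
  \<open>a [^] n = b [^] n \<Longrightarrow> a = b\<close>.
\<close>

locale torsionless_monoid = comm_monoid_cancel M for M (structure) +
  assumes torsionless:
    "\<lbrakk>a \<in> carrier M; b \<in> carrier M; 0 < (n::nat); a [^] n = b [^] n\<rbrakk> \<Longrightarrow> a = b"

text \<open>
  In \<open>decomposition\<close>, the family \<open>c\<close> of homogeneous components of \<open>x\<close> is extensional
  (undefined off \<open>carrier \<Gamma>\<close>), so that its uniqueness is that of the components.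
  The components \<open>A \<alpha>\<close> may be zero, and \<open>A\<close> is arbitrary off \<open>carrier \<Gamma>\<close>.
\<close>

locale graded_domain =
  \<Gamma>: torsionless_monoid \<Gamma> + domain R
  for \<Gamma> :: "('i, 'n) monoid_scheme"
    and R :: "('a, 'm) ring_scheme" (structure)
    and A :: "'i \<Rightarrow> 'a set" +
  assumes nontrivial_grading: "carrier \<Gamma> \<noteq> {\<one>\<^bsub>\<Gamma>\<^esub>}"
    and component_subgroup: "\<alpha> \<in> carrier \<Gamma> \<Longrightarrow> additive_subgroup (A \<alpha>) R"
    and component_mult:
      "\<lbrakk>\<alpha> \<in> carrier \<Gamma>; \<beta> \<in> carrier \<Gamma>; x \<in> A \<alpha>; y \<in> A \<beta>\<rbrakk> \<Longrightarrow> x \<otimes> y \<in> A (\<alpha> \<otimes>\<^bsub>\<Gamma>\<^esub> \<beta>)"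
    and decomposition:
      "x \<in> carrier R \<Longrightarrow>
        \<exists>!c. c \<in> (\<Pi>\<^sub>E \<alpha>\<in>carrier \<Gamma>. A \<alpha>) \<and> finite {\<alpha> \<in> carrier \<Gamma>. c \<alpha> \<noteq> \<zero>} \<and>
             x = (\<Oplus>\<alpha>\<in>{\<alpha> \<in> carrier \<Gamma>. c \<alpha> \<noteq> \<zero>}. c \<alpha>)"

text \<open>
  An extension \<open>R \<subseteq> T\<close>: the smaller ring and the smaller monoid are given by their carriers
  \<open>R\<close> and \<open>\<Gamma>\<close>, with the structure induced from \<open>T\<close> and \<open>\<Lambda>\<close>. A subsemigroup of the
  cancellative \<open>\<Lambda>\<close> that is itself a monoid has the same identity as \<open>\<Lambda>\<close>, so \<open>submonoid\<close> is
  no restriction. The gradings of \<open>R\<close> and \<open>T\<close> are \<open>A\<close> and \<open>B\<close>.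
\<close>

locale graded_domain_extension =
  T: graded_domain \<Lambda> T B +
  R: graded_domain "\<Lambda>\<lparr>carrier := \<Gamma>\<rparr>" "T\<lparr>carrier := R\<rparr>" A
  for \<Lambda> :: "('i, 'n) monoid_scheme"
    and T :: "('a, 'm) ring_scheme"
    and B :: "'i \<Rightarrow> 'a set"
    and \<Gamma> :: "'i set"
    and R :: "'a set"
    and A :: "'i \<Rightarrow> 'a set" +
  assumes submonoid: "submonoid \<Gamma> \<Lambda>"
    and subring: "subring R T"
    and component_subset: "\<alpha> \<in> \<Gamma> \<Longrightarrow> A \<alpha> \<subseteq> B \<alpha>"


section \<open>Homogeneous spectra\<close>

text \<open>Below, \<open>D\<close> is the set of degrees of the grading \<open>A\<close>.\<close>

definition homogeneous_ideal ::
    "'i set \<Rightarrow> ('a, 'm) ring_scheme \<Rightarrow> ('i \<Rightarrow> 'a set) \<Rightarrow> 'a set \<Rightarrow> bool" where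
  "homogeneous_ideal D R A I \<longleftrightarrow> (\<exists>S \<subseteq> (\<Union>\<alpha>\<in>D. A \<alpha>). I = Idl\<^bsub>R\<^esub> S)"

definition Spec :: "('a, 'm) ring_scheme \<Rightarrow> 'a set set" where
  "Spec R = {P. primeideal P R}"

definition Spec_h ::
    "'i set \<Rightarrow> ('a, 'm) ring_scheme \<Rightarrow> ('i \<Rightarrow> 'a set) \<Rightarrow> 'a set set" where
  "Spec_h D R A = {P \<in> Spec R. homogeneous_ideal D R A P}"

text \<open>The open sets are the complements of \<open>V(S) = {P \<in> Spec R. S \<subseteq> P}\<close>.\<close>

definition zariski_topology :: "('a, 'm) ring_scheme \<Rightarrow> 'a set topology" where
  "zariski_topology R = topology (\<lambda>U. \<exists>S \<subseteq> carrier R. U = {P \<in> Spec R. \<not> S \<subseteq> P})"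

lemma istopology_zariski:
  "istopology (\<lambda>U. \<exists>S \<subseteq> carrier R. U = {P \<in> Spec R. \<not> S \<subseteq> P})"
  unfolding istopology_def
proof (intro conjI allI impI)
  fix U V
  assume "\<exists>S \<subseteq> carrier R. U = {P \<in> Spec R. \<not> S \<subseteq> P}" "\<exists>S \<subseteq> carrier R. V = {P \<in> Spec R. \<not> S \<subseteq> P}"
  then obtain S S' where S: "S \<subseteq> carrier R" "U = {P \<in> Spec R. \<not> S \<subseteq> P}"
    and S': "S' \<subseteq> carrier R" "V = {P \<in> Spec R. \<not> S' \<subseteq> P}"
    by blast
  define W where "W = {s \<otimes>\<^bsub>R\<^esub> s' | s s'. s \<in> S \<and> s' \<in> S'}"
  have "(\<not> W \<subseteq> P) \<longleftrightarrow> (\<not> S \<subseteq> P) \<and> (\<not> S' \<subseteq> P)" if "P \<in> Spec R" for P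
  proof -
    interpret primeideal P R
      using that by (simp add: Spec_def)
    show ?thesis
      unfolding W_def using S(1) S'(1) I_prime I_l_closed I_r_closed by blast
  qed
  then have "U \<inter> V = {P \<in> Spec R. \<not> W \<subseteq> P}"
    using S(2) S'(2) by blast
  moreover have "W \<subseteq> carrier R" if "P \<in> Spec R" for P
  proof -
    interpret primeideal P R
      using that by (simp add: Spec_def)
    show ?thesis
      unfolding W_def using S(1) S'(1) by blast
  qed
  ultimately show "\<exists>S \<subseteq> carrier R. U \<inter> V = {P \<in> Spec R. \<not> S \<subseteq> P}"
    by (metis (no_types, lifting) all_not_in_conv empty_subsetI mem_Collect_eq)
next
  fix \<U>
  assume "\<forall>U\<in>\<U>. \<exists>S \<subseteq> carrier R. U = {P \<in> Spec R. \<not> S \<subseteq> P}"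
  then obtain S where S: "\<And>U. U \<in> \<U> \<Longrightarrow> S U \<subseteq> carrier R \<and> U = {P \<in> Spec R. \<not> S U \<subseteq> P}"
    by metis
  then have "\<Union>\<U> = {P \<in> Spec R. \<not> (\<Union>U\<in>\<U>. S U) \<subseteq> P}"
    by blast
  then show "\<exists>S \<subseteq> carrier R. \<Union>\<U> = {P \<in> Spec R. \<not> S \<subseteq> P}"
    using S by (metis UN_least)
qed

lemma openin_zariski:
  "openin (zariski_topology R) U \<longleftrightarrow> (\<exists>S \<subseteq> carrier R. U = {P \<in> Spec R. \<not> S \<subseteq> P})"
  unfolding zariski_topology_def by (simp add: topology_inverse'[OF istopology_zariski])

lemma topspace_zariski: "topspace (zariski_topology R) = Spec R"
proof (rule equalityI)
  show "topspace (zariski_topology R) \<subseteq> Spec R"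
    unfolding topspace_def openin_zariski by blast
  have "\<not> carrier R \<subseteq> P" if "P \<in> Spec R" for P
  proof -
    interpret primeideal P R
      using that by (simp add: Spec_def)
    show ?thesis
      using I_notcarr a_subset by blast
  qed
  then have "Spec R = {P \<in> Spec R. \<not> carrier R \<subseteq> P}"
    by blast
  then have "openin (zariski_topology R) (Spec R)"
    unfolding openin_zariski by blast
  then show "Spec R \<subseteq> topspace (zariski_topology R)"
    by (rule openin_subset)
qed

definition Spec_h_topology ::
    "'i set \<Rightarrow> ('a, 'm) ring_scheme \<Rightarrow> ('i \<Rightarrow> 'a set) \<Rightarrow> 'a set topology" where
  "Spec_h_topology D R A = subtopology (zariski_topology R) (Spec_h D R A)"

lemma topspace_Spec_h: "topspace (Spec_h_topology D R A) = Spec_h D R A"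
  by (auto simp: Spec_h_topology_def topspace_subtopology topspace_zariski Spec_h_def)


section \<open>Graded going-down\<close>

definition gGD ::
    "('i, 'n) monoid_scheme \<Rightarrow> ('a, 'm) ring_scheme \<Rightarrow> ('i \<Rightarrow> 'a set) \<Rightarrow>
     'i set \<Rightarrow> 'a set \<Rightarrow> ('i \<Rightarrow> 'a set) \<Rightarrow> bool" where
  "gGD \<Lambda> T B \<Gamma> R A \<longleftrightarrow>
    (\<forall>P0 \<in> Spec_h \<Gamma> (T\<lparr>carrier := R\<rparr>) A. \<forall>P \<in> Spec_h \<Gamma> (T\<lparr>carrier := R\<rparr>) A.
      \<forall>Q \<in> Spec_h (carrier \<Lambda>) T B.
        P0 \<subseteq> P \<and> Q \<inter> R = P \<longrightarrow>
          (\<exists>Q0 \<in> Spec_h (carrier \<Lambda>) T B. Q0 \<subseteq> Q \<and> Q0 \<inter> R = P0))"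

end

theory Submission
  imports Defs "HOL-Algebra.Ring_Divisibility"
begin

text \<open>
  Let \<open>P0 \<subseteq> P\<close> be homogeneous primes of \<open>R\<close> and let \<open>Q\<close> lie over \<open>P\<close>. Call an element of \<open>T\<close>
  bad if it is a product \<open>t s\<close> with \<open>t \<in> T - Q\<close> and \<open>s \<in> R - P0\<close>. A prime \<open>Q'\<close> of \<open>T\<close> that
  contains \<open>P0\<close> and no bad element is contained in \<open>Q\<close> and contracts to \<open>P0\<close>. The bad elements are
  closed under multiplication, so Krull's lemma (\<open>exists_prime_disjoint\<close>) provides such a \<open>Q'\<close> as
  soon as the ideal \<open>P0 T\<close> contains no bad element.

  This is where openness enters. For \<open>t \<notin> Q\<close>, the image under \<open>F\<close> of the open set of all
  homogeneous primes avoiding \<open>t\<close> is open and contains \<open>P\<close>. Open sets are stable under passing to a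
  smaller prime, so the image contains \<open>P0\<close>, that is, some homogeneous prime \<open>Q\<^sub>t\<close> over \<open>P0\<close>
  avoids \<open>t\<close>. If \<open>t s\<close> were in \<open>P0 T \<subseteq> Q\<^sub>t\<close>, then
  \<open>s \<in> Q\<^sub>t \<inter> R = P0\<close> because \<open>t \<notin> Q\<^sub>t\<close>, which contradicts \<open>s \<notin> P0\<close>.

  The prime \<open>Q'\<close> need not be homogeneous. It is replaced by its homogeneous core, the set of elements
  all of whose components lie in \<open>Q'\<close>. The core still contains the generators of the homogeneous
  ideal \<open>P0\<close>, so it too contracts to \<open>P0\<close>. That it is prime (\<open>primeideal_core\<close>) depends on the
  grading monoid being torsionless. If \<open>x\<close> and \<open>y\<close> lie outside the core, consider the finitely many
  degrees in which \<open>x\<close>, respectively \<open>y\<close>, has a component outside \<open>Q'\<close>. Some product of a degree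
  of \<open>x\<close> and a degree of \<open>y\<close> arises in one way only (\<open>unique_product\<close>), and in that degree
  \<open>x y\<close> has a component outside \<open>Q'\<close>. Unique products come from orders
  compatible with multiplication that are total on the given finite sets of degrees; such an order
  can be built by making one pair comparable at a time.
\<close>

section \<open>Orders and unique products in torsionless monoids\<close>

text \<open>
  Requiring an equivalence in the last clause makes these exactly the partial orders that extend to
  the group of fractions as compatible partial orders.
\<close>

definition (in comm_monoid_cancel) compatible_order :: "('a \<Rightarrow> 'a \<Rightarrow> bool) \<Rightarrow> bool" where
  "compatible_order r \<longleftrightarrow>
    (\<forall>x\<in>carrier G. r x x) \<and>
    (\<forall>x\<in>carrier G. \<forall>y\<in>carrier G. r x y \<longrightarrow> r y x \<longrightarrow> x = y) \<and>
    (\<forall>x\<in>carrier G. \<forall>y\<in>carrier G. \<forall>z\<in>carrier G. r x y \<longrightarrow> r y z \<longrightarrow> r x z) \<and>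
    (\<forall>x\<in>carrier G. \<forall>y\<in>carrier G. \<forall>z\<in>carrier G. r (x \<otimes> z) (y \<otimes> z) \<longleftrightarrow> r x y)"

context comm_monoid_cancel
begin

lemma compatible_orderD:
  assumes "compatible_order r"
  shows "x \<in> carrier G \<Longrightarrow> r x x"
    and "\<lbrakk>x \<in> carrier G; y \<in> carrier G; r x y; r y x\<rbrakk> \<Longrightarrow> x = y"
    and "\<lbrakk>x \<in> carrier G; y \<in> carrier G; z \<in> carrier G; r x y; r y z\<rbrakk> \<Longrightarrow> r x z"
    and "\<lbrakk>x \<in> carrier G; y \<in> carrier G; z \<in> carrier G\<rbrakk> \<Longrightarrow> r (x \<otimes> z) (y \<otimes> z) \<longleftrightarrow> r x y"
  using assms unfolding compatible_order_def by blast+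

lemma compatible_order_mult_mono:
  assumes "compatible_order r" "x \<in> carrier G" "y \<in> carrier G" "u \<in> carrier G" "v \<in> carrier G"
    and "r x y" "r u v"
  shows "r (x \<otimes> u) (y \<otimes> v)"
proof -
  have "r (x \<otimes> u) (y \<otimes> u)"
    using assms by (simp add: compatible_orderD(4))
  moreover have "r (y \<otimes> u) (y \<otimes> v)"
    using compatible_orderD(4)[OF assms(1), of u v y] assms by (simp add: m_comm)
  ultimately show ?thesis
    using compatible_orderD(3)[OF assms(1), of "x \<otimes> u" "y \<otimes> u" "y \<otimes> v"] assms by simp
qed

lemma compatible_order_pow_mono:
  assumes "compatible_order r" "x \<in> carrier G" "y \<in> carrier G" "r x y"
  shows "r (x [^] (n::nat)) (y [^] n)"
proof (induction n)
  case 0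
  then show ?case using assms by (simp add: compatible_orderD(1))
next
  case (Suc n)
  then show ?case using assms by (simp add: compatible_order_mult_mono)
qed

text \<open>
  In the group of fractions, written additively, the new relation is obtained by adding \<open>b - a\<close>
  to the cone of nonnegative elements. The only obstruction is that the cone may already contain
  a positive multiple of \<open>a - b\<close>.
\<close>

lemma compatible_order_adjoin:
  assumes r: "compatible_order r" and a: "a \<in> carrier G" and b: "b \<in> carrier G"
    and obstruction: "\<And>n. 0 < (n::nat) \<Longrightarrow> \<not> r (b [^] n) (a [^] n)"
  shows "\<exists>r'. compatible_order r' \<and> r \<le> r' \<and> r' a b"
proof -
  define s where "s = (\<lambda>x y. \<exists>k::nat. r (x \<otimes> b [^] k) (y \<otimes> a [^] k))"
  \<comment> \<open>On the carrier \<open>r'\<close> is \<open>s\<close>; the disjunct \<open>r x y\<close> gives \<open>r \<le> r'\<close> off the carrier as well.\<close>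
  define r' where "r' = (\<lambda>x y. r x y \<or> s x y)"
  note [simp] = a b
  have s: "r' x y \<longleftrightarrow> s x y" if "x \<in> carrier G" "y \<in> carrier G" for x y
  proof -
    have "s x y" if "r x y"
      unfolding s_def using that \<open>x \<in> carrier G\<close> \<open>y \<in> carrier G\<close> by (intro exI[of _ 0]) simp
    then show ?thesis by (auto simp: r'_def)
  qed
  have refl: "s x x" if "x \<in> carrier G" for x
    unfolding s_def using that r by (intro exI[of _ 0]) (simp add: compatible_orderD(1))
  have antisym: "x = y" if xy: "x \<in> carrier G" "y \<in> carrier G" "s x y" "s y x" for x y
  proof -
    obtain k l :: nat where k: "r (x \<otimes> b [^] k) (y \<otimes> a [^] k)"
      and l: "r (y \<otimes> b [^] l) (x \<otimes> a [^] l)"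
      using xy by (auto simp: s_def)
    have "r ((x \<otimes> b [^] k) \<otimes> (y \<otimes> b [^] l)) ((y \<otimes> a [^] k) \<otimes> (x \<otimes> a [^] l))"
      by (rule compatible_order_mult_mono[OF r _ _ _ _ k l]) (use xy in auto)
    moreover have "(x \<otimes> b [^] k) \<otimes> (y \<otimes> b [^] l) = b [^] (k + l) \<otimes> (x \<otimes> y)"
      "(y \<otimes> a [^] k) \<otimes> (x \<otimes> a [^] l) = a [^] (k + l) \<otimes> (x \<otimes> y)"
      using xy by (simp_all add: nat_pow_mult[symmetric] m_ac)
    ultimately have "r (b [^] (k + l)) (a [^] (k + l))"
      using compatible_orderD(4)[OF r] xy by simp
    then have "\<not> 0 < k + l"
      using obstruction by blast
    then have "k = 0" "l = 0" by simp_all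
    then show ?thesis
      using k l xy by (intro compatible_orderD(2)[OF r]) simp_all
  qed
  have trans: "s x z"
    if xyz: "x \<in> carrier G" "y \<in> carrier G" "z \<in> carrier G" "s x y" "s y z" for x y z
  proof -
    obtain k l :: nat where k: "r (x \<otimes> b [^] k) (y \<otimes> a [^] k)"
      and l: "r (y \<otimes> b [^] l) (z \<otimes> a [^] l)"
      using xyz by (auto simp: s_def)
    have "r ((x \<otimes> b [^] k) \<otimes> (y \<otimes> b [^] l)) ((y \<otimes> a [^] k) \<otimes> (z \<otimes> a [^] l))"
      by (rule compatible_order_mult_mono[OF r _ _ _ _ k l]) (use xyz in auto)
    moreover have "(x \<otimes> b [^] k) \<otimes> (y \<otimes> b [^] l) = (x \<otimes> b [^] (k + l)) \<otimes> y"
      "(y \<otimes> a [^] k) \<otimes> (z \<otimes> a [^] l) = (z \<otimes> a [^] (k + l)) \<otimes> y"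
      using xyz by (simp_all add: nat_pow_mult[symmetric] m_ac)
    ultimately have "r (x \<otimes> b [^] (k + l)) (z \<otimes> a [^] (k + l))"
      using compatible_orderD(4)[OF r] xyz by simp
    then show ?thesis by (auto simp: s_def)
  qed
  have mult: "s (x \<otimes> z) (y \<otimes> z) \<longleftrightarrow> s x y"
    if xyz: "x \<in> carrier G" "y \<in> carrier G" "z \<in> carrier G" for x y z
  proof -
    have "r ((x \<otimes> z) \<otimes> b [^] k) ((y \<otimes> z) \<otimes> a [^] k) \<longleftrightarrow> r (x \<otimes> b [^] k) (y \<otimes> a [^] k)"
      for k :: nat
    proof -
      have "(x \<otimes> z) \<otimes> b [^] k = (x \<otimes> b [^] k) \<otimes> z" "(y \<otimes> z) \<otimes> a [^] k = (y \<otimes> a [^] k) \<otimes> z"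
        using xyz by (simp_all add: m_ac)
      then show ?thesis
        using xyz by (simp add: compatible_orderD(4)[OF r])
    qed
    then show ?thesis by (simp add: s_def)
  qed
  have "compatible_order r'"
    unfolding compatible_order_def
  proof (intro conjI ballI impI)
    fix x y z assume c: "x \<in> carrier G" "y \<in> carrier G" "z \<in> carrier G"
    show "r' (x \<otimes> z) (y \<otimes> z) \<longleftrightarrow> r' x y" using mult[OF c] s c by simp
    show "r' x z" if "r' x y" "r' y z" using trans[OF c] s c that by simp
  next
    fix x y assume c: "x \<in> carrier G" "y \<in> carrier G"
    show "x = y" if "r' x y" "r' y x" using antisym[OF c] s c that by simp
  next
    fix x assume "x \<in> carrier G"
    then show "r' x x" using refl s by simp
  qed
  moreover have "r' a b"
    unfolding r'_def s_def using r
    by (intro disjI2 exI[of _ 1]) (simp add: m_comm compatible_orderD(1))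
  ultimately show ?thesis
    by (auto simp: r'_def le_fun_def)
qed

end

context torsionless_monoid
begin

text \<open>
  In the torsionless case \<open>b - a\<close> or \<open>a - b\<close> can be adjoined: if both were obstructed, some positive
  multiple of \<open>a - b\<close> would be both nonnegative and nonpositive.
\<close>

lemma compatible_order_extend:
  assumes r: "compatible_order r" and a: "a \<in> carrier M" and b: "b \<in> carrier M"
  shows "\<exists>r'. compatible_order r' \<and> r \<le> r' \<and> (r' a b \<or> r' b a)"
proof (rule ccontr)
  assume none: "\<not> ?thesis"
  obtain n :: nat where n: "0 < n" "r (b [^] n) (a [^] n)"
    using compatible_order_adjoin[OF r a b] none by blast
  obtain m :: nat where m: "0 < m" "r (a [^] m) (b [^] m)"
    using compatible_order_adjoin[OF r b a] none by blast
  \<comment> \<open>The powers of exponent \<open>m n\<close> agree by antisymmetry, hence \<open>a = b\<close>.\<close>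
  have "r (a [^] (m * n)) (b [^] (m * n))"
    using compatible_order_pow_mono[OF r _ _ m(2), of n] a b by (simp add: nat_pow_pow)
  moreover have "r (b [^] (m * n)) (a [^] (m * n))"
    using compatible_order_pow_mono[OF r _ _ n(2), of m] a b by (simp add: nat_pow_pow mult.commute)
  ultimately have "a [^] (m * n) = b [^] (m * n)"
    by (intro compatible_orderD(2)[OF r] nat_pow_closed a b)
  then have "a = b"
    by (rule torsionless[OF a b, rotated]) (use m n in simp)
  then have "r a b"
    using compatible_orderD(1)[OF r a] by simp
  then show False
    using none r by blast
qed

lemma exists_order_comparing:
  assumes "finite F" "F \<subseteq> carrier M \<times> carrier M"
  shows "\<exists>r. compatible_order r \<and> (\<forall>(a, b)\<in>F. r a b \<or> r b a)"
  using assms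
proof (induction F rule: finite_induct)
  case empty
  have "compatible_order (=)"
    by (auto simp: compatible_order_def dest: r_cancel)
  then show ?case by blast
next
  case (insert p F)
  then obtain r where r: "compatible_order r" "\<forall>(a, b)\<in>F. r a b \<or> r b a"
    by auto
  obtain a b where p: "p = (a, b)" "a \<in> carrier M" "b \<in> carrier M"
    using insert.prems by auto
  obtain r' where "compatible_order r'" "r \<le> r'" "r' a b \<or> r' b a"
    using compatible_order_extend[OF r(1) p(2,3)] by blast
  then show ?case
    using r(2) p(1) by (intro exI[of _ r']) (auto simp: le_fun_def)
qed

lemma exists_order_greatest:
  assumes r: "compatible_order r" and X: "finite X" "X \<noteq> {}" "X \<subseteq> carrier M"
    and total: "\<forall>a\<in>X. \<forall>b\<in>X. r a b \<or> r b a"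
  shows "\<exists>m\<in>X. \<forall>x\<in>X. r x m"
  using X total
proof (induction X rule: finite_ne_induct)
  case (singleton x)
  then show ?case using compatible_orderD(1)[OF r, of x] by simp
next
  case (insert x X)
  have "\<exists>m\<in>X. \<forall>y\<in>X. r y m"
    by (rule insert.IH) (use insert.prems in simp_all)
  then obtain m where m: "m \<in> X" "\<forall>y\<in>X. r y m" by blast
  show ?case
  proof (cases "r x m")
    case True
    then show ?thesis using m by blast
  next
    case False
    then have "r m x" using insert.prems(2) m(1) by fastforce
    have "r y x" if "y \<in> X" for y
      by (rule compatible_orderD(3)[OF r _ _ _ _ \<open>r m x\<close>]) (use m that insert.prems(1) in auto)
    then show ?thesis using insert.prems(1) compatible_orderD(1)[OF r, of x] by simp
  qed
qed

text \<open>
  Take \<open>x\<close> and \<open>y\<close> greatest in \<open>X\<close> and \<open>Y\<close> for a compatible order that is total on each of them;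
  replacing either by a smaller element makes the product smaller.
\<close>

lemma unique_product:
  assumes X: "finite X" "X \<noteq> {}" "X \<subseteq> carrier M" and Y: "finite Y" "Y \<noteq> {}" "Y \<subseteq> carrier M"
  obtains x y where "x \<in> X" "y \<in> Y"
    "\<And>x' y'. \<lbrakk>x' \<in> X; y' \<in> Y; x' \<otimes> y' = x \<otimes> y\<rbrakk> \<Longrightarrow> x' = x \<and> y' = y"
proof -
  obtain r where r: "compatible_order r" and total: "\<forall>(a, b)\<in>(X \<times> X) \<union> (Y \<times> Y). r a b \<or> r b a"
    using exists_order_comparing[of "(X \<times> X) \<union> (Y \<times> Y)"] X Y by auto
  obtain x where x: "x \<in> X" "\<forall>x'\<in>X. r x' x"
    using exists_order_greatest[OF r X] total by blast
  obtain y where y: "y \<in> Y" "\<forall>y'\<in>Y. r y' y"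
    using exists_order_greatest[OF r Y] total by blast
  have "x' = x \<and> y' = y" if eq: "x' \<in> X" "y' \<in> Y" "x' \<otimes> y' = x \<otimes> y" for x' y'
  proof -
    have c: "x \<in> carrier M" "y \<in> carrier M" "x' \<in> carrier M" "y' \<in> carrier M"
      using eq x y X Y by blast+
    have "r (x' \<otimes> y') (x \<otimes> y')"
      using c x(2) eq(1) compatible_orderD(4)[OF r] by blast
    moreover have "r (x \<otimes> y') (x \<otimes> y)"
      using c y(2) eq(2) r by (simp add: compatible_order_mult_mono compatible_orderD(1))
    ultimately have "x \<otimes> y' = x \<otimes> y"
      using eq(3) c by (intro compatible_orderD(2)[OF r]) simp_all
    then have "y' = y" using c l_cancel by blast
    then show ?thesis using eq(3) c r_cancel by blast
  qed
  then show ?thesis using that x(1) y(1) by blast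
qed

end

section \<open>Prime ideals avoiding a multiplicative set\<close>

text \<open>
  Krull's lemma. An ideal \<open>Q\<close> that is maximal among the ideals disjoint from \<open>S\<close> is prime: if \<open>a\<close> and
  \<open>b\<close> lie outside \<open>Q\<close>, then \<open>S\<close> meets both \<open>Q + (a)\<close> and \<open>Q + (b)\<close>, hence their product, which
  is contained in \<open>Q + (a b)\<close>.
\<close>

lemma (in cring) exists_prime_disjoint:
  assumes I: "ideal I R" and disj: "I \<inter> S = {}" and ne: "S \<noteq> {}" and S: "S \<subseteq> carrier R"
    and mult: "\<And>s t. \<lbrakk>s \<in> S; t \<in> S\<rbrakk> \<Longrightarrow> s \<otimes> t \<in> S"
  obtains Q where "primeideal Q R" "I \<subseteq> Q" "Q \<inter> S = {}"
proof -
  define \<A> where "\<A> = {J. ideal J R \<and> I \<subseteq> J \<and> J \<inter> S = {}}"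
  have "\<Union>\<C> \<in> \<A>" if "\<C> \<noteq> {}" "subset.chain \<A> \<C>" for \<C>
  proof -
    have sub: "\<C> \<subseteq> \<A>" and "subset.chain {I. ideal I R} \<C>"
      using that(2) by (auto simp: \<A>_def pred_on.chain_def)
    then have "ideal (\<Union>\<C>) R"
      using chain_Union_is_ideal[of \<C>] that(1) by simp
    then show ?thesis using sub that(1) by (auto simp: \<A>_def)
  qed
  moreover have "\<A> \<noteq> {}" using I disj by (auto simp: \<A>_def)
  ultimately obtain Q where Q: "Q \<in> \<A>" and max: "\<forall>J\<in>\<A>. Q \<subseteq> J \<longrightarrow> J = Q"
    using subset_Zorn_nonempty[of \<A>] by blast
  interpret Q: ideal Q R using Q by (simp add: \<A>_def)
  have hits: "\<exists>q\<in>Q. \<exists>r\<in>carrier R. q \<oplus> r \<otimes> a \<in> S" if a: "a \<in> carrier R" "a \<notin> Q" for a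
  proof -
    define J where "J = Q <+>\<^bsub>R\<^esub> PIdl a"
    have J: "ideal J R"
      unfolding J_def by (intro add_ideals Q.is_ideal cgenideal_ideal a)
    have elem: "q \<oplus> r \<otimes> a \<in> J" if "q \<in> Q" "r \<in> carrier R" for q r
      using that unfolding J_def set_add_def' cgenideal_def by blast
    have "Q \<subseteq> J"
    proof
      fix q assume q: "q \<in> Q"
      then show "q \<in> J" using elem[of q \<zero>] a Q.a_Hcarr by simp
    qed
    moreover have "a \<in> J" using elem[of \<zero> \<one>] a by simp
    ultimately have "J \<notin> \<A>" using max a(2) by blast
    then have "J \<inter> S \<noteq> {}" using J \<open>Q \<subseteq> J\<close> Q by (auto simp: \<A>_def)
    then show ?thesis
      unfolding J_def set_add_def' cgenideal_def by blast
  qed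
  have "primeideal Q R"
  proof (rule primeidealI)
    show "ideal Q R" by (rule Q.is_ideal)
    show "cring R" by (rule is_cring)
    show "carrier R \<noteq> Q" using Q ne S by (auto simp: \<A>_def)
    fix a b assume a: "a \<in> carrier R" and b: "b \<in> carrier R" and ab: "a \<otimes> b \<in> Q"
    show "a \<in> Q \<or> b \<in> Q"
    proof (rule ccontr)
      assume "\<not> (a \<in> Q \<or> b \<in> Q)"
      then obtain q r q' r' where q: "q \<in> Q" "r \<in> carrier R" "q \<oplus> r \<otimes> a \<in> S"
        and q': "q' \<in> Q" "r' \<in> carrier R" "q' \<oplus> r' \<otimes> b \<in> S"
        using hits[OF a] hits[OF b] by blast
      have c: "q \<in> carrier R" "q' \<in> carrier R" using q q' Q.a_Hcarr by auto
      have "(q \<oplus> r \<otimes> a) \<otimes> (q' \<oplus> r' \<otimes> b)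
          = (q' \<oplus> r' \<otimes> b) \<otimes> q \<oplus> ((r \<otimes> a) \<otimes> q' \<oplus> (r \<otimes> r') \<otimes> (a \<otimes> b))"
        using c q(2) q'(2) a b by algebra
      also have "\<dots> \<in> Q"
      proof (intro additive_subgroup.a_closed[OF Q.additive_subgroup_axioms])
        show "(q' \<oplus> r' \<otimes> b) \<otimes> q \<in> Q"
          by (rule Q.I_l_closed[OF q(1)]) (use c q'(2) b in simp)
        show "(r \<otimes> a) \<otimes> q' \<in> Q"
          by (rule Q.I_l_closed[OF q'(1)]) (use q(2) a in simp)
        show "(r \<otimes> r') \<otimes> (a \<otimes> b) \<in> Q"
          by (rule Q.I_l_closed[OF ab]) (use q(2) q'(2) in simp)
      qed
      finally show False using mult[OF q(3) q'(3)] Q unfolding \<A>_def by blast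
    qed
  qed
  then show ?thesis using that[of Q] Q unfolding \<A>_def by blast
qed

section \<open>Homogeneous components\<close>

lemma (in ideal) finsum_mem:
  assumes "\<And>i. i \<in> S \<Longrightarrow> f i \<in> I"
  shows "(\<Oplus>i\<in>S. f i) \<in> I"
  using assms
proof (induction S rule: infinite_finite_induct)
  case (insert i S)
  then have "f \<in> S \<rightarrow> carrier R" "f i \<in> carrier R" by (auto dest: a_Hcarr)
  then show ?case using insert by (simp add: finsum_insert)
qed simp_all

lemma (in ideal) finsum_mem_imp_term_mem:
  assumes "finite S" "k \<in> S" "f \<in> S \<rightarrow> carrier R" "(\<Oplus>i\<in>S. f i) \<in> I"
    and "\<And>i. \<lbrakk>i \<in> S; i \<noteq> k\<rbrakk> \<Longrightarrow> f i \<in> I"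
  shows "f k \<in> I"
proof -
  define t where "t = (\<Oplus>i\<in>S - {k}. f i)"
  have t: "t \<in> I" unfolding t_def using assms(5) by (intro finsum_mem) auto
  have c: "f k \<in> carrier R" "t \<in> carrier R" using assms(2,3) a_Hcarr[OF t] by auto
  have "(\<Oplus>i\<in>insert k (S - {k}). f i) = f k \<oplus> t"
    unfolding t_def using assms(1-3) by (intro finsum_insert) auto
  then have "f k \<oplus> t \<in> I" using assms(2,4) by (simp add: insert_absorb)
  then have "(f k \<oplus> t) \<oplus> (\<ominus> t) \<in> I" using additive_subgroup.a_closed[OF additive_subgroup_axioms]
      additive_subgroup.a_inv_closed[OF additive_subgroup_axioms t] by blast
  moreover have "(f k \<oplus> t) \<oplus> (\<ominus> t) = f k" using c by algebra
  ultimately show ?thesis by simp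
qed

context graded_domain
begin

definition component :: "'i \<Rightarrow> 'a \<Rightarrow> 'a" where
  "component \<alpha> x =
    (THE c. c \<in> (\<Pi>\<^sub>E \<alpha>\<in>carrier \<Gamma>. A \<alpha>) \<and> finite {\<alpha> \<in> carrier \<Gamma>. c \<alpha> \<noteq> \<zero>} \<and>
       x = (\<Oplus>\<alpha>\<in>{\<alpha> \<in> carrier \<Gamma>. c \<alpha> \<noteq> \<zero>}. c \<alpha>)) \<alpha>"

definition support :: "'a \<Rightarrow> 'i set" where
  "support x = {\<alpha> \<in> carrier \<Gamma>. component \<alpha> x \<noteq> \<zero>}"

lemma homogeneous_carrier: "\<lbrakk>\<alpha> \<in> carrier \<Gamma>; x \<in> A \<alpha>\<rbrakk> \<Longrightarrow> x \<in> carrier R"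
  using additive_subgroup.a_Hcarr component_subgroup by fast

lemma zero_homogeneous: "\<alpha> \<in> carrier \<Gamma> \<Longrightarrow> \<zero> \<in> A \<alpha>"
  using additive_subgroup.zero_closed component_subgroup by fast

lemma components:
  assumes "x \<in> carrier R"
  shows component_homogeneous: "\<alpha> \<in> carrier \<Gamma> \<Longrightarrow> component \<alpha> x \<in> A \<alpha>"
    and finite_support: "finite (support x)"
    and sum_components: "(\<Oplus>\<alpha>\<in>support x. component \<alpha> x) = x"
  using theI'[OF decomposition[OF assms]] unfolding support_def component_def
  by (auto dest: PiE_mem)

lemma component_closed: "\<lbrakk>x \<in> carrier R; \<alpha> \<in> carrier \<Gamma>\<rbrakk> \<Longrightarrow> component \<alpha> x \<in> carrier R"
  using component_homogeneous homogeneous_carrier by blast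

lemma component_eqI:
  assumes F: "finite F" "F \<subseteq> carrier \<Gamma>" and d: "\<And>\<alpha>. \<alpha> \<in> F \<Longrightarrow> d \<alpha> \<in> A \<alpha>"
    and \<gamma>: "\<gamma> \<in> carrier \<Gamma>"
  shows "component \<gamma> (\<Oplus>\<alpha>\<in>F. d \<alpha>) = (if \<gamma> \<in> F then d \<gamma> else \<zero>)"
proof -
  define c where "c = (\<lambda>\<alpha>\<in>carrier \<Gamma>. if \<alpha> \<in> F then d \<alpha> else \<zero>)"
  let ?x = "\<Oplus>\<alpha>\<in>F. d \<alpha>"
  let ?S = "{\<alpha> \<in> carrier \<Gamma>. c \<alpha> \<noteq> \<zero>}"
  have dc: "d \<in> F \<rightarrow> carrier R" using F d homogeneous_carrier by blast
  have S: "?S = {\<alpha>\<in>F. d \<alpha> \<noteq> \<zero>}" using F(2) by (auto simp: c_def)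
  have "(\<Oplus>\<alpha>\<in>?S. c \<alpha>) = ?x"
    unfolding S using F dc
    by (intro add.finprod_mono_neutral_cong_left) (auto simp: c_def)
  moreover have "c \<in> (\<Pi>\<^sub>E \<alpha>\<in>carrier \<Gamma>. A \<alpha>)"
    using d zero_homogeneous by (auto simp: c_def)
  moreover have "finite ?S" unfolding S using F(1) by simp
  ultimately have "c \<in> (\<Pi>\<^sub>E \<alpha>\<in>carrier \<Gamma>. A \<alpha>) \<and> finite ?S \<and> ?x = (\<Oplus>\<alpha>\<in>?S. c \<alpha>)"
    by simp
  then have "component \<gamma> ?x = c \<gamma>"
    unfolding component_def
    using the1_equality[OF decomposition[OF finsum_closed[OF dc]]] by presburger
  then show ?thesis using \<gamma> by (simp add: c_def)
qed

lemma component_of_homogeneous: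
  assumes "\<beta> \<in> carrier \<Gamma>" "x \<in> A \<beta>" "\<gamma> \<in> carrier \<Gamma>"
  shows "component \<gamma> x = (if \<gamma> = \<beta> then x else \<zero>)"
  using component_eqI[of "{\<beta>}" "\<lambda>_. x" \<gamma>] assms homogeneous_carrier
  by (auto simp: finsum_insert)

lemma component_add:
  assumes x: "x \<in> carrier R" and y: "y \<in> carrier R" and \<gamma>: "\<gamma> \<in> carrier \<Gamma>"
  shows "component \<gamma> (x \<oplus> y) = component \<gamma> x \<oplus> component \<gamma> y"
proof -
  let ?F = "support x \<union> support y"
  have F: "finite ?F" "?F \<subseteq> carrier \<Gamma>"
    using x y finite_support by (auto simp: support_def)
  have extend: "(\<Oplus>\<alpha>\<in>?F. component \<alpha> z) = z" if "z \<in> {x, y}" for z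
  proof -
    have z: "z \<in> carrier R" using that x y by auto
    have "(\<Oplus>\<alpha>\<in>support z. component \<alpha> z) = (\<Oplus>\<alpha>\<in>?F. component \<alpha> z)"
      using F z that
      by (intro add.finprod_mono_neutral_cong_left) (auto simp: support_def component_closed)
    then show ?thesis using sum_components[OF z] by simp
  qed
  have "x \<oplus> y = (\<Oplus>\<alpha>\<in>?F. component \<alpha> x) \<oplus> (\<Oplus>\<alpha>\<in>?F. component \<alpha> y)"
    by (simp add: extend)
  also have "\<dots> = (\<Oplus>\<alpha>\<in>?F. component \<alpha> x \<oplus> component \<alpha> y)"
    using F x y by (intro finsum_addf[symmetric]) (auto intro: component_closed)
  finally have "component \<gamma> (x \<oplus> y)
      = component \<gamma> (\<Oplus>\<alpha>\<in>?F. component \<alpha> x \<oplus> component \<alpha> y)"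
    by simp
  also have "\<dots> = (if \<gamma> \<in> ?F then component \<gamma> x \<oplus> component \<gamma> y else \<zero>)"
  proof (rule component_eqI[OF F _ \<gamma>])
    fix \<alpha> assume "\<alpha> \<in> ?F"
    then have "\<alpha> \<in> carrier \<Gamma>" using F(2) by blast
    then show "component \<alpha> x \<oplus> component \<alpha> y \<in> A \<alpha>"
      using x y by (intro additive_subgroup.a_closed[OF component_subgroup] component_homogeneous)
  qed
  also have "\<dots> = component \<gamma> x \<oplus> component \<gamma> y"
    using \<gamma> by (auto simp: support_def)
  finally show ?thesis .
qed

lemma component_zero: "\<gamma> \<in> carrier \<Gamma> \<Longrightarrow> component \<gamma> \<zero> = \<zero>"
  using component_eqI[of "{}" undefined \<gamma>] by simp

lemma component_finsum:
  assumes "finite S" "f \<in> S \<rightarrow> carrier R" and \<gamma>: "\<gamma> \<in> carrier \<Gamma>"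
  shows "component \<gamma> (\<Oplus>i\<in>S. f i) = (\<Oplus>i\<in>S. component \<gamma> (f i))"
  using assms(1,2)
proof (induction S rule: finite_induct)
  case empty
  then show ?case using \<gamma> by (simp add: component_zero)
next
  case (insert i S)
  then have f: "f i \<in> carrier R" "f \<in> S \<rightarrow> carrier R" by auto
  then have "(\<lambda>i. component \<gamma> (f i)) \<in> S \<rightarrow> carrier R" "component \<gamma> (f i) \<in> carrier R"
    using \<gamma> component_closed by auto
  then show ?case
    using insert f \<gamma> by (simp add: finsum_insert component_add)
qed

lemma component_mult_expand:
  assumes x: "x \<in> carrier R" and y: "y \<in> carrier R" and \<gamma>: "\<gamma> \<in> carrier \<Gamma>"
  shows "component \<gamma> (x \<otimes> y) =
    (\<Oplus>\<alpha>\<in>support x. \<Oplus>\<beta>\<in>support y. component \<gamma> (component \<alpha> x \<otimes> component \<beta> y))"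
proof -
  have cx: "component \<alpha> x \<in> carrier R" if "\<alpha> \<in> support x" for \<alpha>
    using that x component_closed by (auto simp: support_def)
  have cy: "component \<beta> y \<in> carrier R" if "\<beta> \<in> support y" for \<beta>
    using that y component_closed by (auto simp: support_def)
  have "x \<otimes> y = (\<Oplus>\<alpha>\<in>support x. component \<alpha> x) \<otimes> y"
    using x sum_components by simp
  also have "\<dots> = (\<Oplus>\<alpha>\<in>support x. component \<alpha> x \<otimes> y)"
    using x y cx by (intro finsum_ldistr finite_support) auto
  finally have "component \<gamma> (x \<otimes> y) = (\<Oplus>\<alpha>\<in>support x. component \<gamma> (component \<alpha> x \<otimes> y))"
    using x y cx \<gamma> by (simp add: component_finsum finite_support)
  also have "\<dots> = (\<Oplus>\<alpha>\<in>support x. \<Oplus>\<beta>\<in>support y. component \<gamma> (component \<alpha> x \<otimes> component \<beta> y))"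
  proof (intro finsum_cong' refl)
    show "(\<lambda>\<alpha>. \<Oplus>\<beta>\<in>support y. component \<gamma> (component \<alpha> x \<otimes> component \<beta> y))
        \<in> support x \<rightarrow> carrier R"
      using cx cy \<gamma> by (auto intro!: finsum_closed component_closed)
    fix \<alpha> assume \<alpha>: "\<alpha> \<in> support x"
    have "component \<alpha> x \<otimes> y = component \<alpha> x \<otimes> (\<Oplus>\<beta>\<in>support y. component \<beta> y)"
      using y sum_components by simp
    also have "\<dots> = (\<Oplus>\<beta>\<in>support y. component \<alpha> x \<otimes> component \<beta> y)"
      using y cx[OF \<alpha>] cy by (intro finsum_rdistr finite_support) auto
    finally show "component \<gamma> (component \<alpha> x \<otimes> y)
        = (\<Oplus>\<beta>\<in>support y. component \<gamma> (component \<alpha> x \<otimes> component \<beta> y))"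
      using y cx[OF \<alpha>] cy \<gamma> by (simp add: component_finsum finite_support)
  qed
  finally show ?thesis .
qed

lemma component_of_mult_homogeneous:
  assumes "x \<in> carrier R" "y \<in> carrier R" "\<alpha> \<in> carrier \<Gamma>" "\<beta> \<in> carrier \<Gamma>" "\<gamma> \<in> carrier \<Gamma>"
  shows "component \<gamma> (component \<alpha> x \<otimes> component \<beta> y) =
    (if \<gamma> = \<alpha> \<otimes>\<^bsub>\<Gamma>\<^esub> \<beta> then component \<alpha> x \<otimes> component \<beta> y else \<zero>)"
  using assms component_homogeneous component_mult component_of_homogeneous by simp

section \<open>The homogeneous core of a prime ideal\<close>

text \<open>For an ideal \<open>P\<close> this is usually written \<open>P*\<close>, the largest homogeneous ideal inside \<open>P\<close>.\<close>

definition core :: "'a set \<Rightarrow> 'a set" where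
  "core P = {x \<in> carrier R. \<forall>\<alpha>\<in>carrier \<Gamma>. component \<alpha> x \<in> P}"

lemma core_subset:
  assumes "ideal P R"
  shows "core P \<subseteq> P"
proof
  interpret ideal P R by fact
  fix x assume "x \<in> core P"
  then have "x \<in> carrier R" "(\<Oplus>\<alpha>\<in>support x. component \<alpha> x) \<in> P"
    by (auto simp: core_def support_def intro!: finsum_mem)
  then show "x \<in> P" by (simp add: sum_components)
qed

lemma homogeneous_mem_core:
  assumes "ideal P R" "\<alpha> \<in> carrier \<Gamma>" "x \<in> A \<alpha>" "x \<in> P"
  shows "x \<in> core P"
proof -
  interpret ideal P R by fact
  show ?thesis
    using assms homogeneous_carrier by (auto simp: core_def component_of_homogeneous)
qed

lemma ideal_core:
  assumes "ideal P R"
  shows "ideal (core P) R"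
proof -
  interpret P: ideal P R by fact
  have mult: "r \<otimes> x \<in> core P" if r: "r \<in> carrier R" and x: "x \<in> core P" for r x
  proof -
    have xc: "x \<in> carrier R" using x by (simp add: core_def)
    have "component \<gamma> (r \<otimes> x) \<in> P" if \<gamma>: "\<gamma> \<in> carrier \<Gamma>" for \<gamma>
      unfolding component_mult_expand[OF r xc \<gamma>]
    proof (intro P.finsum_mem)
      fix \<alpha> \<beta> assume "\<alpha> \<in> support r" "\<beta> \<in> support x"
      then have \<alpha>\<beta>: "\<alpha> \<in> carrier \<Gamma>" "\<beta> \<in> carrier \<Gamma>" by (auto simp: support_def)
      then have "component \<alpha> r \<otimes> component \<beta> x \<in> P"
        using x r by (auto simp: core_def intro: P.I_l_closed component_closed)
      then show "component \<gamma> (component \<alpha> r \<otimes> component \<beta> x) \<in> P"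
        using component_of_mult_homogeneous[OF r xc \<alpha>\<beta> \<gamma>] by simp
    qed
    then show ?thesis using r xc by (simp add: core_def)
  qed
  show ?thesis
  proof (rule idealI[OF ring_axioms])
    show "subgroup (core P) (add_monoid R)"
    proof (rule add.subgroupI)
      show "core P \<subseteq> carrier R" by (auto simp: core_def)
      have "\<zero> \<in> core P" by (simp add: core_def component_zero)
      then show "core P \<noteq> {}" by blast
      show "\<ominus> x \<in> core P" if "x \<in> core P" for x
      proof -
        have "(\<ominus> \<one>) \<otimes> x = \<ominus> x" using that by (simp add: core_def l_minus)
        then show ?thesis using mult[of "\<ominus> \<one>" x] that by simp
      qed
      show "x \<oplus> y \<in> core P" if "x \<in> core P" "y \<in> core P" for x y
        using that by (auto simp: core_def component_add)
    qed
    show "r \<otimes> x \<in> core P" if "x \<in> core P" "r \<in> carrier R" for x r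
      using mult that by blast
    then show "x \<otimes> r \<in> core P" if "x \<in> core P" "r \<in> carrier R" for x r
      using that m_comm[of x r] by (simp add: core_def)
  qed
qed

lemma homogeneous_ideal_core:
  assumes P: "ideal P R"
  shows "homogeneous_ideal (carrier \<Gamma>) R A (core P)"
proof -
  let ?H = "\<Union>\<alpha>\<in>carrier \<Gamma>. A \<alpha>"
  let ?S = "core P \<inter> ?H"
  interpret core: ideal "core P" R by (rule ideal_core[OF P])
  have Sc: "?S \<subseteq> carrier R" using core.a_subset by blast
  have "x \<in> Idl ?S" if x: "x \<in> core P" for x
  proof -
    have xc: "x \<in> carrier R" using x by (rule core.a_Hcarr)
    have "component \<alpha> x \<in> Idl ?S" if "\<alpha> \<in> support x" for \<alpha>
    proof -
      have \<alpha>: "\<alpha> \<in> carrier \<Gamma>" using that by (simp add: support_def)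
      have "component \<alpha> x \<in> P" using x \<alpha> unfolding core_def by blast
      then have "component \<alpha> x \<in> ?S"
        using homogeneous_mem_core[OF P \<alpha>] component_homogeneous[OF xc \<alpha>] \<alpha> by blast
      then show ?thesis using genideal_self[OF Sc] by blast
    qed
    then have "(\<Oplus>\<alpha>\<in>support x. component \<alpha> x) \<in> Idl ?S" 
      by (rule ideal.finsum_mem[OF genideal_ideal[OF Sc]])
    then show ?thesis by (simp add: sum_components[OF xc])
  qed
  moreover have "Idl ?S \<subseteq> core P" by (rule genideal_minimal[OF core.is_ideal]) simp
  ultimately have "core P = Idl ?S" by (intro equalityI subsetI) blast+
  then show ?thesis unfolding homogeneous_ideal_def by (intro exI[of _ ?S] conjI) simp_all
qed

text \<open>
  Modulo \<open>P\<close>, only the components of \<open>x\<close> and \<open>y\<close> outside \<open>P\<close> matter. A unique product of their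
  degrees isolates a single product of components in \<open>x y\<close>, and \<open>P\<close> is prime.
\<close>

lemma primeideal_core:
  assumes P: "primeideal P R"
  shows "primeideal (core P) R"
proof -
  interpret P: primeideal P R by fact
  show ?thesis
  proof (rule primeidealI[OF ideal_core[OF P.is_ideal] is_cring])
    show "carrier R \<noteq> core P"
      using core_subset[OF P.is_ideal] P.I_notcarr P.a_subset by blast
    fix x y assume x: "x \<in> carrier R" and y: "y \<in> carrier R" and xy: "x \<otimes> y \<in> core P"
    show "x \<in> core P \<or> y \<in> core P"
    proof (rule ccontr)
      assume "\<not> (x \<in> core P \<or> y \<in> core P)"
      define N where "N z = {\<alpha> \<in> carrier \<Gamma>. component \<alpha> z \<notin> P}" for z
      have N_support: "N z \<subseteq> support z" for z by (auto simp: N_def support_def)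
      have "N x \<noteq> {}" "N y \<noteq> {}"
        using \<open>\<not> (x \<in> core P \<or> y \<in> core P)\<close> x y by (auto simp: N_def core_def)
      moreover have "finite (N x)" "finite (N y)"
        using finite_subset[OF N_support] finite_support x y by auto
      moreover have "N x \<subseteq> carrier \<Gamma>" "N y \<subseteq> carrier \<Gamma>" by (auto simp: N_def)
      ultimately obtain \<alpha> \<beta> where \<alpha>: "\<alpha> \<in> N x" and \<beta>: "\<beta> \<in> N y"
        and unique: "\<And>\<alpha>' \<beta>'. \<lbrakk>\<alpha>' \<in> N x; \<beta>' \<in> N y; \<alpha>' \<otimes>\<^bsub>\<Gamma>\<^esub> \<beta>' = \<alpha> \<otimes>\<^bsub>\<Gamma>\<^esub> \<beta>\<rbrakk>
          \<Longrightarrow> \<alpha>' = \<alpha> \<and> \<beta>' = \<beta>"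
        using \<Gamma>.unique_product[of "N x" "N y"] by metis
      define \<gamma> where "\<gamma> = \<alpha> \<otimes>\<^bsub>\<Gamma>\<^esub> \<beta>"
      have c: "\<alpha> \<in> carrier \<Gamma>" "\<beta> \<in> carrier \<Gamma>" "\<gamma> \<in> carrier \<Gamma>"
        using \<alpha> \<beta> by (auto simp: N_def \<gamma>_def)
      define t where "t \<alpha>' \<beta>' = component \<gamma> (component \<alpha>' x \<otimes> component \<beta>' y)" for \<alpha>' \<beta>'
      have t_closed: "t \<alpha>' \<beta>' \<in> carrier R" if "\<alpha>' \<in> support x" "\<beta>' \<in> support y" for \<alpha>' \<beta>'
        using that x y c by (auto simp: t_def support_def intro!: component_closed)
      have t_mem: "t \<alpha>' \<beta>' \<in> P"
        if s: "\<alpha>' \<in> support x" "\<beta>' \<in> support y" and ne: "\<alpha>' \<noteq> \<alpha> \<or> \<beta>' \<noteq> \<beta>" for \<alpha>' \<beta>'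
      proof -
        have c': "\<alpha>' \<in> carrier \<Gamma>" "\<beta>' \<in> carrier \<Gamma>" using s by (auto simp: support_def)
        have "component \<alpha>' x \<otimes> component \<beta>' y \<in> P" if "\<gamma> = \<alpha>' \<otimes>\<^bsub>\<Gamma>\<^esub> \<beta>'"
        proof -
          have "\<alpha>' \<notin> N x \<or> \<beta>' \<notin> N y" using unique ne that by (auto simp: \<gamma>_def)
          then show ?thesis
            using c' x y by (auto simp: N_def intro: P.I_l_closed P.I_r_closed component_closed)
        qed
        then show ?thesis
          using component_of_mult_homogeneous[OF x y c' c(3)] by (simp add: t_def)
      qed
      have sum: "(\<Oplus>\<alpha>'\<in>support x. \<Oplus>\<beta>'\<in>support y. t \<alpha>' \<beta>') \<in> P"
        unfolding t_def component_mult_expand[OF x y c(3), symmetric]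
        using xy c(3) by (simp add: core_def)
      have "(\<Oplus>\<beta>'\<in>support y. t \<alpha> \<beta>') \<in> P"
      proof (rule P.finsum_mem_imp_term_mem[OF _ _ _ sum])
        show "finite (support x)" by (rule finite_support[OF x])
        show "\<alpha> \<in> support x" using \<alpha> N_support by blast
        show "(\<lambda>\<alpha>'. \<Oplus>\<beta>'\<in>support y. t \<alpha>' \<beta>') \<in> support x \<rightarrow> carrier R"
          using t_closed by (auto intro!: finsum_closed)
        show "(\<Oplus>\<beta>'\<in>support y. t \<alpha>' \<beta>') \<in> P" if "\<alpha>' \<in> support x" "\<alpha>' \<noteq> \<alpha>" for \<alpha>'
          using that t_mem by (intro P.finsum_mem) blast
      qed
      then have "t \<alpha> \<beta> \<in> P"
      proof (rule P.finsum_mem_imp_term_mem[rotated 3])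
        show "finite (support y)" by (rule finite_support[OF y])
        show "\<beta> \<in> support y" using \<beta> N_support by blast
        show "t \<alpha> \<in> support y \<rightarrow> carrier R" using t_closed \<alpha> N_support by blast
        show "t \<alpha> \<beta>' \<in> P" if "\<beta>' \<in> support y" "\<beta>' \<noteq> \<beta>" for \<beta>'
          using that t_mem \<alpha> N_support by blast
      qed
      then have "component \<alpha> x \<otimes> component \<beta> y \<in> P"
        using component_of_mult_homogeneous[OF x y c] by (simp add: t_def \<gamma>_def)
      then show False
        using P.I_prime component_closed x y c \<alpha> \<beta> by (auto simp: N_def)
    qed
  qed
qed

lemma core_in_Spec_h:
  "primeideal P R \<Longrightarrow> core P \<in> Spec_h (carrier \<Gamma>) R A"
  by (simp add: Spec_h_def Spec_def primeideal_core homogeneous_ideal_core primeideal.axioms(1))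

end

section \<open>Going-down\<close>

lemma ideal_inter_subring:
  assumes "ideal I T" "subring R T"
  shows "ideal (I \<inter> R) (T\<lparr>carrier := R\<rparr>)"
proof -
  interpret I: ideal I T by fact
  note R = subringE[OF assms(2)]
  have "subgroup R (add_monoid T)" using assms(2) by (rule subring.axioms(1))
  then have "subgroup (I \<inter> R) (add_monoid T)"
    by (rule I.add.subgroups_Inter_pair[OF I.a_subgroup])
  then have "subgroup (I \<inter> R) ((add_monoid T)\<lparr>carrier := R\<rparr>)"
    using \<open>subgroup R (add_monoid T)\<close> by (rule I.add.subgroup_incl) simp
  then have "subgroup (I \<inter> R) (add_monoid (T\<lparr>carrier := R\<rparr>))" by simp
  then show ?thesis
  proof (rule idealI[OF I.subring_is_ring[OF assms(2)]])
    fix a x assume "a \<in> I \<inter> R" "x \<in> carrier (T\<lparr>carrier := R\<rparr>)"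
    then have a: "a \<in> I" "a \<in> R" and x: "x \<in> R" "x \<in> carrier T" using R(1) by auto
    show "x \<otimes>\<^bsub>T\<lparr>carrier := R\<rparr>\<^esub> a \<in> I \<inter> R"
      using I.I_l_closed[OF a(1) x(2)] R(6)[OF x(1) a(2)] by simp
    show "a \<otimes>\<^bsub>T\<lparr>carrier := R\<rparr>\<^esub> x \<in> I \<inter> R"
      using I.I_r_closed[OF a(1) x(2)] R(6)[OF a(2) x(1)] by simp
  qed
qed

text \<open>
  If \<open>P\<close> misses some element of the set defining an open set, so does every smaller prime.
\<close>

lemma openin_Spec_h_generization:
  assumes "openin (Spec_h_topology D R A) U" "P \<in> U" "P0 \<in> Spec_h D R A" "P0 \<subseteq> P"
  shows "P0 \<in> U"
  using assms by (auto simp: Spec_h_topology_def openin_subtopology openin_zariski Spec_h_def)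

lemma openin_Spec_h_basic:
  assumes "t \<in> carrier R"
  shows "openin (Spec_h_topology D R A) {P \<in> Spec_h D R A. t \<notin> P}"
  unfolding Spec_h_topology_def openin_subtopology openin_zariski
  using assms by (intro exI[of _ "{P \<in> Spec R. \<not> {t} \<subseteq> P}"]) (auto simp: Spec_h_def)

text \<open>
  All that going-down needs of openness: primes below \<open>F Q\<close> are hit by homogeneous primes that
  avoid any one prescribed element outside \<open>Q\<close>. These primes depend on the element.
\<close>

lemma open_map_avoiding_prime:
  assumes "open_map (Spec_h_topology D T B) (Spec_h_topology D' S A) F"
    and "Q \<in> Spec_h D T B" "P0 \<in> Spec_h D' S A" "P0 \<subseteq> F Q" "t \<in> carrier T" "t \<notin> Q"
  obtains Q' where "Q' \<in> Spec_h D T B" "t \<notin> Q'" "F Q' = P0"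
proof -
  have "openin (Spec_h_topology D' S A) (F ` {Q \<in> Spec_h D T B. t \<notin> Q})"
    using assms(1) openin_Spec_h_basic[OF assms(5)] unfolding open_map_def by blast
  then have "P0 \<in> F ` {Q \<in> Spec_h D T B. t \<notin> Q}"
    using openin_Spec_h_generization[OF _ _ assms(3,4)] assms(2,6) by blast
  then show ?thesis using that by blast
qed

text \<open>
  Passing to the core keeps the homogeneous generators of \<open>P0\<close>, since they stay homogeneous in \<open>T\<close>,
  and the contraction of the core is an ideal, so it contains all of \<open>P0\<close>.
\<close>

lemma (in graded_domain_extension) core_lies_over:
  assumes Q: "ideal Q T" and lies: "Q \<inter> R = P0"
    and P0: "homogeneous_ideal \<Gamma> (T\<lparr>carrier := R\<rparr>) A P0"
  shows "T.core Q \<inter> R = P0"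
proof
  show "T.core Q \<inter> R \<subseteq> P0" using T.core_subset[OF Q] lies by blast
  obtain S where S: "S \<subseteq> (\<Union>\<alpha>\<in>\<Gamma>. A \<alpha>)" "P0 = Idl\<^bsub>T\<lparr>carrier := R\<rparr>\<^esub> S"
    using P0 by (auto simp: homogeneous_ideal_def)
  have "S \<subseteq> R" using S(1) R.homogeneous_carrier by fastforce
  then have "S \<subseteq> P0" using S(2) R.genideal_self[of S] by simp
  have "S \<subseteq> T.core Q \<inter> R"
  proof
    fix s assume "s \<in> S"
    then obtain \<alpha> where "\<alpha> \<in> \<Gamma>" "s \<in> A \<alpha>" "s \<in> Q" "s \<in> R"
      using S(1) \<open>S \<subseteq> P0\<close> lies by blast
    then show "s \<in> T.core Q \<inter> R"
      using T.homogeneous_mem_core[OF Q, of \<alpha> s] component_subset submonoid.subset[OF submonoid]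
      by blast
  qed
  moreover have "ideal (T.core Q \<inter> R) (T\<lparr>carrier := R\<rparr>)"
    by (rule ideal_inter_subring[OF T.ideal_core[OF Q] subring])
  ultimately show "P0 \<subseteq> T.core Q \<inter> R"
    unfolding S(2) using R.genideal_minimal by blast
qed

text \<open>
  Krull's lemma merges the primes avoiding single elements into one prime that avoids every
  element outside \<open>Q\<close>. The factors \<open>s \<in> R - P0\<close> in the multiplicative set keep that prime from
  contracting to more than \<open>P0\<close>.
\<close>

lemma (in graded_domain_extension) exists_prime_below:
  assumes Q: "primeideal Q T" and P0: "primeideal P0 (T\<lparr>carrier := R\<rparr>)"
    and avoiding: "\<And>t. \<lbrakk>t \<in> carrier T; t \<notin> Q\<rbrakk> \<Longrightarrow> \<exists>Q'. primeideal Q' T \<and> t \<notin> Q' \<and> Q' \<inter> R = P0"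
  obtains Q' where "primeideal Q' T" "Q' \<subseteq> Q" "Q' \<inter> R = P0"
proof -
  interpret Q: primeideal Q T by fact
  interpret P0: primeideal P0 "T\<lparr>carrier := R\<rparr>" by fact
  note sub = subringE[OF subring]
  have P0R: "P0 \<subseteq> R" using P0.a_subset by simp
  then have P0T: "P0 \<subseteq> carrier T" using sub(1) by blast
  define I where "I = Idl\<^bsub>T\<^esub> P0"
  define S where "S = {t \<otimes>\<^bsub>T\<^esub> s | t s. t \<in> carrier T - Q \<and> s \<in> R - P0}"
  have I: "ideal I T" unfolding I_def by (rule T.genideal_ideal[OF P0T])
  have "P0 \<subseteq> I" unfolding I_def by (rule T.genideal_self[OF P0T])
  have one: "\<one>\<^bsub>T\<^esub> \<in> carrier T - Q" "\<one>\<^bsub>T\<^esub> \<in> R - P0"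
    using Q.one_imp_carrier Q.I_notcarr P0.one_imp_carrier P0.I_notcarr sub(3) by auto
  have mult: "u \<otimes>\<^bsub>T\<^esub> v \<in> S" if u: "u \<in> S" and v: "v \<in> S" for u v
  proof -
    obtain t s t' s' where uv: "u = t \<otimes>\<^bsub>T\<^esub> s" "v = t' \<otimes>\<^bsub>T\<^esub> s'"
      and t: "t \<in> carrier T" "t \<notin> Q" "t' \<in> carrier T" "t' \<notin> Q"
      and s: "s \<in> R" "s \<notin> P0" "s' \<in> R" "s' \<notin> P0"
      using u v unfolding S_def by blast
    have "t \<otimes>\<^bsub>T\<^esub> t' \<in> carrier T - Q" using t Q.I_prime by auto
    moreover have "s \<otimes>\<^bsub>T\<^esub> s' \<in> R - P0" using s P0.I_prime sub(6) by auto
    moreover have "u \<otimes>\<^bsub>T\<^esub> v = (t \<otimes>\<^bsub>T\<^esub> t') \<otimes>\<^bsub>T\<^esub> (s \<otimes>\<^bsub>T\<^esub> s')"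
      unfolding uv using t s sub(1) by (simp add: T.m_ac subset_iff)
    ultimately show ?thesis unfolding S_def by blast
  qed
  have "I \<inter> S = {}"
  proof (rule ccontr)
    assume "I \<inter> S \<noteq> {}"
    then obtain t s where ts: "t \<otimes>\<^bsub>T\<^esub> s \<in> I"
      and t: "t \<in> carrier T" "t \<notin> Q" and s: "s \<in> R" "s \<notin> P0"
      unfolding S_def by blast
    obtain Q' where Q': "primeideal Q' T" "t \<notin> Q'" "Q' \<inter> R = P0"
      using avoiding[OF t] by blast
    interpret Q': primeideal Q' T by fact
    have "I \<subseteq> Q'" unfolding I_def using Q'(3) by (intro T.genideal_minimal Q'.is_ideal) blast
    then have "s \<in> Q'" using ts Q'.I_prime[of t s] t s sub(1) Q'(2) by blast
    then show False using s Q'(3) by blast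
  qed
  moreover have "S \<noteq> {}" using one unfolding S_def by blast
  moreover have "S \<subseteq> carrier T" unfolding S_def using sub(1) by auto
  ultimately obtain Q' where Q': "primeideal Q' T" "I \<subseteq> Q'" "Q' \<inter> S = {}"
    using T.exists_prime_disjoint[OF I _ _ _ mult] by blast
  interpret Q': primeideal Q' T by fact
  have "Q' \<subseteq> Q"
  proof
    fix t assume t: "t \<in> Q'"
    then have tc: "t \<in> carrier T" by (rule Q'.a_Hcarr)
    show "t \<in> Q"
    proof (rule ccontr)
      assume "t \<notin> Q"
      then have "t \<otimes>\<^bsub>T\<^esub> \<one>\<^bsub>T\<^esub> \<in> S" unfolding S_def using tc one(2) by blast
      then show False using t tc Q'(3) by auto
    qed
  qed
  moreover have "Q' \<inter> R = P0"
  proof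
    show "P0 \<subseteq> Q' \<inter> R" using \<open>P0 \<subseteq> I\<close> Q'(2) P0R by blast
    show "Q' \<inter> R \<subseteq> P0"
    proof
      fix s assume s: "s \<in> Q' \<inter> R"
      then have sc: "s \<in> carrier T" using sub(1) by blast
      show "s \<in> P0"
      proof (rule ccontr)
        assume "s \<notin> P0"
        then have "\<one>\<^bsub>T\<^esub> \<otimes>\<^bsub>T\<^esub> s \<in> S" unfolding S_def using s one(1) by blast
        then show False using s sc Q'(3) by auto
      qed
    qed
  qed
  ultimately show ?thesis using that Q'(1) by blast
qed

theorem proposition2p2:
  fixes \<Lambda> :: "('i, 'n) monoid_scheme"
    and T :: "('a, 'm) ring_scheme"
    and B :: "'i \<Rightarrow> 'a set"
    and \<Gamma> :: "'i set"
    and R :: "'a set"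
    and A :: "'i \<Rightarrow> 'a set"
  assumes "graded_domain_extension \<Lambda> T B \<Gamma> R A"
    and "open_map (Spec_h_topology (carrier \<Lambda>) T B)
                  (Spec_h_topology \<Gamma> (T\<lparr>carrier := R\<rparr>) A)
                  (\<lambda>Q. Q \<inter> R)"
  shows "gGD \<Lambda> T B \<Gamma> R A"
  unfolding gGD_def
proof (intro ballI impI)
  interpret graded_domain_extension \<Lambda> T B \<Gamma> R A by fact
  fix P0 P Q
  assume P0: "P0 \<in> Spec_h \<Gamma> (T\<lparr>carrier := R\<rparr>) A" and Q: "Q \<in> Spec_h (carrier \<Lambda>) T B"
    and "P0 \<subseteq> P \<and> Q \<inter> R = P"
  then have sub: "P0 \<subseteq> Q \<inter> R" by blast
  have avoiding: "\<exists>Q'. primeideal Q' T \<and> t \<notin> Q' \<and> Q' \<inter> R = P0"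
    if "t \<in> carrier T" "t \<notin> Q" for t
    using open_map_avoiding_prime[OF assms(2) Q P0 sub that] by (auto simp: Spec_h_def Spec_def)
  obtain Q' where Q': "primeideal Q' T" "Q' \<subseteq> Q" "Q' \<inter> R = P0"
    using exists_prime_below[OF _ _ avoiding] Q P0 by (auto simp: Spec_h_def Spec_def)
  have ideal: "ideal Q' T" using Q'(1) by (rule primeideal.axioms(1))
  show "\<exists>Q0 \<in> Spec_h (carrier \<Lambda>) T B. Q0 \<subseteq> Q \<and> Q0 \<inter> R = P0"
  proof (intro bexI conjI)
    show "T.core Q' \<in> Spec_h (carrier \<Lambda>) T B" by (rule T.core_in_Spec_h[OF Q'(1)])
    show "T.core Q' \<subseteq> Q" using T.core_subset[OF ideal] Q'(2) by blast
    show "T.core Q' \<inter> R = P0"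
      using core_lies_over[OF ideal Q'(3)] P0 by (simp add: Spec_h_def)
  qed
qed

end
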